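(* The ERI space $X=(X_0,\tau_{\mathrm{ERI}})$ is compact.
   Context: Let $\overline{\mathbb{R}}=[-\infty,+\infty]$ be the extended real line with its order topology. Let $\sim$ be the equivalence relation on $\overline{\mathbb{R}}$ whose only non-singleton class is $\{-\infty,0,+\infty\}$, let $X_0=\overline{\mathbb{R}}/{\sim}$ be the quotient set, $q\colon\overline{\mathbb{R}}\to X_0$ the projection, and $\ast=q(-\infty)=q(0)=q(+\infty)$. The ERI topology $\tau_{\mathrm{ERI}}$ on $X_0$ consists of all $U\subseteq X_0$ such that (a) $q^{-1}(U)$ is open in $\overline{\mathbb{R}}$, and (b) if $\ast\in U$ then $q^{-1}(U)$ is dense in $\overline{\mathbb{R}}$. (This is a topology.) The ERI space is $X=(X_0,\tau_{\mathrm{ERI}})$. "Compact" means every open cover has a finite subcover (no Hausdorff assumption). *)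

theory Defs
  imports "HOL-Analysis.Analysis"
begin

definition eri_rel :: "(ereal \<times> ereal) set" where
  "eri_rel = {(x, y). x = y \<or> (x \<in> {-\<infinity>, 0, \<infinity>} \<and> y \<in> {-\<infinity>, 0, \<infinity>})}"

lemma equiv_eri_rel: "equiv UNIV eri_rel"
  by (rule equivI) (auto simp: eri_rel_def refl_on_def sym_def trans_def)

definition eri_carrier :: "ereal set set" where
  "eri_carrier = UNIV // eri_rel"

definition eri_proj :: "ereal \<Rightarrow> ereal set" where
  "eri_proj x = eri_rel `` {x}"

definition eri_star :: "ereal set" where
  "eri_star = eri_proj 0"

lemma eri_star_eq: "eri_proj (-\<infinity>) = eri_star" "eri_proj \<infinity> = eri_star"
  by (auto simp: eri_star_def eri_proj_def eri_rel_def)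

definition eri_open :: "ereal set set \<Rightarrow> bool" where
  "eri_open U \<longleftrightarrow> U \<subseteq> eri_carrier \<and> open (eri_proj -` U) \<and>
     (eri_star \<in> U \<longrightarrow> closure (eri_proj -` U) = UNIV)"

(* The constant topology is meaningful only for predicates satisfying istopology;
   istopology_eri_open and openin_eri_space show that this is the case here. *)
definition eri_space :: "ereal set topology" where
  "eri_space = topology eri_open"

lemma istopology_eri_open: "istopology eri_open"
  unfolding istopology_def
proof (intro conjI allI impI)
  fix U V assume U: "eri_open U" and V: "eri_open V"
  let ?P = "eri_proj -` U" and ?Q = "eri_proj -` V"
  have "closure (?P \<inter> ?Q) = UNIV" if "eri_star \<in> U \<inter> V"
  proof -
    have d: "open ?P" "closure ?P = UNIV" "closure ?Q = UNIV"
      using that U V by (auto simp: eri_open_def)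
    have "?P \<subseteq> closure (?P \<inter> ?Q)"
      using open_Int_closure_subset[OF d(1), of ?Q] d(3) by simp
    then have "closure ?P \<subseteq> closure (?P \<inter> ?Q)"
      by (rule closure_minimal) simp
    then show ?thesis using d(2) by auto
  qed
  then show "eri_open (U \<inter> V)"
    using U V by (auto simp: eri_open_def vimage_Int)
next
  fix K assume K: "\<forall>U\<in>K. eri_open U"
  have "closure (eri_proj -` \<Union>K) = UNIV" if "eri_star \<in> \<Union>K"
  proof -
    obtain U where U: "U \<in> K" "eri_star \<in> U" using \<open>eri_star \<in> \<Union>K\<close> by blast
    then have "closure (eri_proj -` U) = UNIV" using K by (auto simp: eri_open_def)
    moreover have "closure (eri_proj -` U) \<subseteq> closure (eri_proj -` \<Union>K)"
      using U by (intro closure_mono) auto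
    ultimately show ?thesis by auto
  qed
  then show "eri_open (\<Union>K)"
    using K unfolding eri_open_def vimage_Union by (auto intro: open_UN)
qed

lemma openin_eri_space: "openin eri_space U \<longleftrightarrow> eri_open U"
  by (simp add: eri_space_def istopology_eri_open topology_inverse')

lemma topspace_eri_space: "topspace eri_space = eri_carrier"
proof -
  have "eri_proj x \<in> eri_carrier" for x
    by (simp add: eri_carrier_def eri_proj_def quotientI)
  then have "eri_open eri_carrier"
    by (simp add: eri_open_def vimage_def)
  then show ?thesis
    by (auto simp: topspace_def openin_eri_space eri_open_def)
qed

end

theory Submission
  imports Defs
begin

text \<open>The extended real line is compact, and compactness passes to continuous images. The
  density clause only removes open sets from the quotient topology, so \<open>eri_proj\<close> stays
  continuous (\<open>continuous_map_eri_proj\<close>); its image is the whole space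
  (\<open>eri_proj_surj\<close>).\<close>

lemma continuous_map_eri_proj: "continuous_map euclidean eri_space eri_proj"
  by (auto simp: continuous_map_def topspace_eri_space openin_eri_space eri_open_def
      eri_carrier_def eri_proj_def vimage_def quotientI)

lemma eri_proj_surj: "range eri_proj = eri_carrier"
  by (auto simp: eri_carrier_def eri_proj_def quotient_def)

theorem proposition2p14:
  shows "compact_space eri_space"
proof -
  have "compactin euclidean (UNIV :: ereal set)"
    \<comment> \<open>In the complete linear order \<open>ereal\<close>, the compact sets are
      exactly the closed ones, and \<open>UNIV\<close> is closed.\<close>
    by (simp add: compact_eq_closed)
  then have "compactin eri_space (range eri_proj)"
    using continuous_map_eri_proj by (rule image_compactin)
  then show ?thesis
    by (simp add: compact_space_def topspace_eri_space eri_proj_surj)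
qed

end
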